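(* For every $n\in\mathbb{N}_0$ and every $x\in\mathbb{R}$ one has $$\arctan^{(n+1)}(x)=\frac{n!\,2^n(-1)^n}{(1+x^2)^{n+1}}\sum_{m=0}^{\lfloor n/2\rfloor}a_{mn}\,x^{n-2m},$$ where $$a_{mn}:=\sum_{k=m}^{\lfloor n/2\rfloor}\frac{(-1)^k}{4^k}\binom{k}{m}\binom{n-k}{k}\qquad\text{for all } m=0,\dots,\lfloor n/2\rfloor.$$
   Context: $\mathbb{N}_0=\{0,1,2,\dots\}$. $\arctan:\mathbb{R}\to\mathbb{R}$ is the real inverse tangent function and $\arctan^{(j)}$ denotes its $j$-th derivative. $\lfloor\cdot\rfloor$ is the floor function, and $x^0=1$ for all real $x$ (including $x=0$). *)

theory Defs
  imports "HOL-Analysis.Analysis"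
begin

(* \<open>acoeff m n\<close> is the coefficient written a with double index mn.
   The floor of n/2 is \<open>n div 2\<close>; all k in the range satisfy 2 * k \<le> n, so the natural
   subtraction \<open>n - k\<close> does not truncate. *)
definition acoeff :: "nat \<Rightarrow> nat \<Rightarrow> real" where
  "acoeff m n = (\<Sum>k = m..n div 2. (-1) ^ k / 4 ^ k * real (k choose m) * real ((n - k) choose k))"

end

theory Submission
  imports Defs
begin

text \<open>The idea is to pass to the complex plane. Since \<open>arctan' x = 1 / (1 + x\<^sup>2)\<close> is the
  imaginary part of \<open>1 / (x - \<i>)\<close>, repeated differentiation shows that the derivative of
  order \<open>n + 1\<close> is \<open>(-1)^n n! Im (1 / (x - \<i>)^(n + 1))\<close> (\<open>higher_deriv_arctan\<close>), and
  \<open>1 / (x - \<i>) = (x + \<i>) / (1 + x\<^sup>2)\<close> turns this into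
  \<open>(-1)^n n! Im ((x + \<i>)^(n + 1)) / (1 + x\<^sup>2)^(n + 1)\<close>.

  It remains to expand \<open>Im ((x + \<i>)^(n + 1))\<close>, which is the quotient
  \<open>(a^(n + 1) - b^(n + 1)) / (a - b)\<close> for the conjugate numbers \<open>a = x + \<i>\<close> and
  \<open>b = x - \<i>\<close>. Such a quotient is a polynomial in \<open>a + b = 2 x\<close> and \<open>a b = 1 + x\<^sup>2\<close>, whose
  coefficients are the signed binomials \<open>(-1)^k (n - k choose k)\<close>
  (\<open>lucas_poly_mult_diff\<close>). Expanding the powers of \<open>1 + x\<^sup>2\<close> by the binomial theorem
  and collecting the powers of \<open>x\<close> produces the double sum that defines the
  coefficients (\<open>acoeff_poly_eq\<close>).\<close>

section \<open>Lucas polynomials\<close>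

text \<open>These are the Lucas polynomials of the first kind (bivariate Fibonacci polynomials), with
  the index shifted by one so that the degree in \<open>p\<close> is \<open>n\<close>.
  Letting \<open>k\<close> run up to \<open>n\<close> rather than \<open>n div 2\<close> only adds terms with vanishing binomial
  coefficient, and it spares the recurrence a case distinction on the parity of \<open>n\<close>.\<close>

definition lucas_poly :: "nat \<Rightarrow> 'a::comm_ring_1 \<Rightarrow> 'a \<Rightarrow> 'a" where
  "lucas_poly n p r = (\<Sum>k\<le>n. of_nat ((n - k) choose k) * p ^ (n - 2 * k) * r ^ k)"

lemma lucas_poly_conv_half:
  "lucas_poly n p r = (\<Sum>k\<le>n div 2. of_nat ((n - k) choose k) * p ^ (n - 2 * k) * r ^ k)"
  unfolding lucas_poly_def
proof (rule sum.mono_neutral_right)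
  show "\<forall>k\<in>{..n} - {..n div 2}. of_nat ((n - k) choose k) * p ^ (n - 2 * k) * r ^ k = 0"
  proof
    fix k assume "k \<in> {..n} - {..n div 2}"
    then have "n - k < k"
      by auto
    then show "of_nat ((n - k) choose k) * p ^ (n - 2 * k) * r ^ k = 0"
      by (simp add: binomial_eq_0)
  qed
qed auto

text \<open>Pascal's rule splits every term but the one for \<open>k = 0\<close> into a term of each summand
  on the right; the term for \<open>k = 0\<close> is that of the first summand.\<close>

lemma lucas_poly_Suc_Suc:
  "lucas_poly (Suc (Suc n)) p r = p * lucas_poly (Suc n) p r + r * lucas_poly n p r"
proof -
  let ?c = "\<lambda>j. of_nat ((n - j) choose Suc j) * p ^ (n - 2 * j) * r ^ Suc j"
  have "lucas_poly (Suc (Suc n)) p r =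
      p ^ Suc (Suc n) + (\<Sum>j\<le>n. of_nat (Suc (n - j) choose Suc j) * p ^ (n - 2 * j) * r ^ Suc j)"
    unfolding lucas_poly_def sum.atMost_Suc_shift[of _ "Suc n"]
    by (simp add: Suc_diff_le del: binomial_Suc_Suc)
  also have "\<dots> = p ^ Suc (Suc n) + (\<Sum>j\<le>n. ?c j) + r * lucas_poly n p r"
    by (simp add: lucas_poly_def sum_distrib_left sum.distrib algebra_simps)
  also have "p ^ Suc (Suc n) + (\<Sum>j\<le>n. ?c j) = p * lucas_poly (Suc n) p r"
  proof -
    \<comment> \<open>One factor \<open>p\<close> can be split off unless the exponent \<open>n - 2 * j\<close> is truncated or zero, and
      then the binomial coefficient vanishes.\<close>
    have "?c j = p * (of_nat ((n - j) choose Suc j) * p ^ (Suc n - 2 * Suc j) * r ^ Suc j)" for j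
    proof (cases "Suc j \<le> n - j")
      case True
      then have "n - 2 * j = Suc (Suc n - 2 * Suc j)"
        by simp
      then show ?thesis
        by (simp only: power_Suc mult_ac)
    next
      case False
      then show ?thesis
        by (simp add: binomial_eq_0)
    qed
    then show ?thesis
      unfolding lucas_poly_def sum.atMost_Suc_shift[of _ n]
      by (simp add: distrib_left sum_distrib_left del: mult_Suc_right power_Suc(1)) simp
  qed
  finally show ?thesis .
qed

text \<open>The two sides agree for \<open>n = 0\<close> and \<open>n = 1\<close>, and both satisfy the recurrence with characteristic polynomial
  \<open>t\<^sup>2 - (a + b) t + a b\<close>, whose roots are \<open>a\<close> and \<open>b\<close>.\<close>

lemma lucas_poly_mult_diff:
  "(a - b) * lucas_poly n (a + b) (- (a * b)) = a ^ Suc n - b ^ Suc n"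
proof (induction n rule: induct_nat_012)
  case (ge2 n)
  have "(a - b) * lucas_poly (Suc (Suc n)) (a + b) (- (a * b)) =
      (a + b) * ((a - b) * lucas_poly (Suc n) (a + b) (- (a * b)))
        - a * b * ((a - b) * lucas_poly n (a + b) (- (a * b)))"
    by (simp add: lucas_poly_Suc_Suc algebra_simps)
  then show ?case
    by (simp only: ge2.IH) (simp add: algebra_simps)
qed (simp_all add: lucas_poly_def algebra_simps)

lemma of_real_lucas_poly:
  "of_real (lucas_poly n p r) =
    (lucas_poly n (of_real p) (of_real r) :: 'a::{real_algebra_1,comm_ring_1})"
  by (simp add: lucas_poly_def)

text \<open>The numbers \<open>x + \<i>\<close> and \<open>x - \<i>\<close> are conjugate with difference \<open>2 \<i>\<close>, so the difference
  of their powers is \<open>2 \<i>\<close> times the imaginary part, and the factor \<open>2 \<i>\<close> cancels.\<close>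

lemma Im_power_eq_lucas_poly:
  "Im ((of_real x + \<i>) ^ Suc n) = lucas_poly n (2 * x) (- (1 + x\<^sup>2))"
proof -
  let ?a = "of_real x + \<i>" and ?b = "of_real x - \<i>"
  have sum: "?a + ?b = of_real (2 * x)" and prod: "- (?a * ?b) = of_real (- (1 + x\<^sup>2))"
    by (simp_all add: algebra_simps power2_eq_square)
  have "?b ^ Suc n = cnj (?a ^ Suc n)"
    by simp
  then have "2 * \<i> * of_real (Im (?a ^ Suc n)) = ?a ^ Suc n - ?b ^ Suc n"
    by (simp only: complex_diff_cnj) (simp add: mult_ac)
  also have "\<dots> = 2 * \<i> * lucas_poly n (?a + ?b) (- (?a * ?b))"
    using lucas_poly_mult_diff[of ?a ?b n] by simp
  also have "\<dots> = 2 * \<i> * of_real (lucas_poly n (2 * x) (- (1 + x\<^sup>2)))"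
    by (simp only: sum prod of_real_lucas_poly)
  finally show ?thesis
    by (simp del: power_Suc)
qed

section \<open>The derivatives of the inverse tangent\<close>

lemma inverse_of_real_minus_i:
  "inverse (of_real x - \<i>) = (of_real x + \<i>) / of_real (1 + x\<^sup>2)"
proof (rule inverse_unique)
  have "(of_real x - \<i>) * (of_real x + \<i>) = of_real (1 + x\<^sup>2)"
    by (simp add: algebra_simps power2_eq_square)
  moreover have "1 + x\<^sup>2 \<noteq> 0"
    by (simp add: add_nonneg_eq_0_iff)
  ultimately show "(of_real x - \<i>) * ((of_real x + \<i>) / of_real (1 + x\<^sup>2)) = 1"
    by (simp only: times_divide_eq_right) (simp del: of_real_add)
qed

text \<open>The function \<open>z \<mapsto> 1 / (z - \<i>)^(n + 1)\<close> is holomorphic off \<open>\<i>\<close>, hence on the real axis; its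
  complex derivative is also its derivative along that axis, and this commutes with \<open>Im\<close>.\<close>

lemma has_real_derivative_Im_inverse_power:
  "((\<lambda>x. Im (inverse (of_real x - \<i>) ^ Suc n)) has_real_derivative
    - real (Suc n) * Im (inverse (of_real x - \<i>) ^ Suc (Suc n))) (at x)"
proof -
  have nz: "complex_of_real x - \<i> \<noteq> 0"
    by (simp add: complex_eq_iff)
  have "((\<lambda>z. inverse (z - \<i>) ^ Suc n) has_field_derivative
      - of_nat (Suc n) * inverse (of_real x - \<i>) ^ Suc (Suc n)) (at (complex_of_real x))"
  proof -
    have "((\<lambda>z. inverse (z - \<i>)) has_field_derivative - (inverse (of_real x - \<i>))\<^sup>2)
        (at (complex_of_real x))"
      using nz by (auto intro!: derivative_eq_intros simp: power2_eq_square)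
    from DERIV_power[OF this, of "Suc n"] show ?thesis
      by (simp add: power2_eq_square algebra_simps)
  qed
  then have "((\<lambda>x. inverse (complex_of_real x - \<i>) ^ Suc n) has_vector_derivative
      - of_nat (Suc n) * inverse (of_real x - \<i>) ^ Suc (Suc n)) (at x)"
    by (rule has_vector_derivative_real_field)
  from bounded_linear.has_vector_derivative[OF bounded_linear_Im this] show ?thesis
    by (simp add: has_real_derivative_iff_has_vector_derivative del: power_Suc of_nat_Suc)
qed

lemma higher_deriv_arctan:
  "(deriv ^^ Suc n) arctan = (\<lambda>x. (-1) ^ n * fact n * Im (inverse (of_real x - \<i>) ^ Suc n))"
proof (induction n)
  case 0
  have "deriv arctan x = inverse (1 + x\<^sup>2)" for x :: real
    by (rule DERIV_imp_deriv) (rule DERIV_arctan)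
  moreover have "Im (inverse (of_real x - \<i>)) = inverse (1 + x\<^sup>2)" for x
    by (simp only: inverse_of_real_minus_i Im_divide_of_real) (simp add: inverse_eq_divide)
  ultimately show ?case
    by (simp add: fun_eq_iff)
next
  case (Suc n)
  have "deriv (\<lambda>x. (-1) ^ n * fact n * Im (inverse (of_real x - \<i>) ^ Suc n)) x =
      (-1) ^ Suc n * fact (Suc n) * Im (inverse (of_real x - \<i>) ^ Suc (Suc n))" for x
  proof -
    define y where "y = Im (inverse (of_real x - \<i>) ^ Suc (Suc n))"
    have "deriv (\<lambda>x. (-1) ^ n * fact n * Im (inverse (of_real x - \<i>) ^ Suc n)) x =
        (-1) ^ n * fact n * (- real (Suc n) * y)"
      unfolding y_def
      by (intro DERIV_imp_deriv DERIV_cmult has_real_derivative_Im_inverse_power)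
    also have "\<dots> = (-1) ^ Suc n * fact (Suc n) * y"
      by (simp add: algebra_simps)
    finally show ?thesis
      by (simp only: y_def)
  qed
  then show ?case
    by (simp only: funpow.simps(2)[of "Suc n"] o_apply Suc.IH)
qed

section \<open>Collecting powers of the variable\<close>

lemma sum_triangle_swap:
  fixes f :: "nat \<Rightarrow> nat \<Rightarrow> 'a::comm_monoid_add"
  shows "(\<Sum>m\<le>N. \<Sum>k = m..N. f m k) = (\<Sum>k\<le>N. \<Sum>m\<le>k. f m k)"
proof -
  have "(\<Sum>m\<le>N. \<Sum>k = m..N. f m k) = (\<Sum>m\<le>N. \<Sum>k | k \<in> {..N} \<and> m \<le> k. f m k)"
    by (intro sum.cong) auto
  also have "\<dots> = (\<Sum>k\<le>N. \<Sum>m | m \<in> {..N} \<and> m \<le> k. f m k)"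
    by (rule sum.swap_restrict) simp_all
  also have "\<dots> = (\<Sum>k\<le>N. \<Sum>m\<le>k. f m k)"
    by (intro sum.cong) auto
  finally show ?thesis .
qed

text \<open>After the order of summation is exchanged, the inner sum over \<open>m\<close> is \<open>x^(n - 2 k)\<close> times
  the binomial expansion of \<open>(1 + x\<^sup>2)^k\<close>.\<close>

lemma acoeff_poly_eq:
  "2 ^ n * (\<Sum>m = 0..n div 2. acoeff m n * x ^ (n - 2 * m)) = lucas_poly n (2 * x) (- (1 + x\<^sup>2))"
proof -
  let ?c = "\<lambda>k. (-1) ^ k / 4 ^ k * real ((n - k) choose k)"
  have inner: "(\<Sum>m\<le>k. real (k choose m) * x ^ (n - 2 * m)) = x ^ (n - 2 * k) * (1 + x\<^sup>2) ^ k"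
    if "k \<le> n div 2" for k
  proof -
    have pow: "x ^ (n - 2 * m) = x ^ (n - 2 * k) * (x\<^sup>2) ^ (k - m)" if "m \<le> k" for m
    proof -
      have "n - 2 * m = (n - 2 * k) + 2 * (k - m)"
        using \<open>m \<le> k\<close> \<open>k \<le> n div 2\<close> by linarith
      then show ?thesis
        by (simp only: power_add power_mult)
    qed
    have "(\<Sum>m\<le>k. real (k choose m) * x ^ (n - 2 * m)) =
        (\<Sum>m\<le>k. x ^ (n - 2 * k) * (real (k choose m) * 1 ^ m * (x\<^sup>2) ^ (k - m)))"
      by (intro sum.cong refl, subst pow) (simp_all add: mult_ac)
    also have "\<dots> = x ^ (n - 2 * k) * (1 + x\<^sup>2) ^ k"
      by (simp only: binomial_ring sum_distrib_left)
    finally show ?thesis .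
  qed
  have "(\<Sum>m = 0..n div 2. acoeff m n * x ^ (n - 2 * m)) =
      (\<Sum>m\<le>n div 2. \<Sum>k = m..n div 2. ?c k * (real (k choose m) * x ^ (n - 2 * m)))"
    by (simp add: acoeff_def sum_distrib_left sum_distrib_right atLeast0AtMost mult_ac)
  also have "\<dots> = (\<Sum>k\<le>n div 2. \<Sum>m\<le>k. ?c k * (real (k choose m) * x ^ (n - 2 * m)))"
    by (rule sum_triangle_swap)
  also have "\<dots> = (\<Sum>k\<le>n div 2. ?c k * (x ^ (n - 2 * k) * (1 + x\<^sup>2) ^ k))"
    by (intro sum.cong refl) (simp only: inner atMost_iff flip: sum_distrib_left)
  \<comment> \<open>The terms now match one by one: the factor \<open>2 ^ n / 4 ^ k\<close> equals \<open>2 ^ (n - 2 * k)\<close>.\<close>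
  also have "2 ^ n * \<dots> = lucas_poly n (2 * x) (- (1 + x\<^sup>2))"
    unfolding lucas_poly_conv_half sum_distrib_left
  proof (rule sum.cong)
    fix k assume "k \<in> {..n div 2}"
    then have "(n - 2 * k) + 2 * k = n"
      by auto
    then have "(2::real) ^ n = 2 ^ (n - 2 * k) * 2 ^ (2 * k)"
      by (simp flip: power_add)
    then have "(2::real) ^ n = 2 ^ (n - 2 * k) * 4 ^ k"
      by (simp add: power_mult)
    then show "2 ^ n * (?c k * (x ^ (n - 2 * k) * (1 + x\<^sup>2) ^ k)) =
        real ((n - k) choose k) * (2 * x) ^ (n - 2 * k) * (- (1 + x\<^sup>2)) ^ k"
      by (simp add: power_mult_distrib power_minus[of "1 + x\<^sup>2"] del: minus_add_distrib)
  qed simp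
  finally show ?thesis .
qed

theorem proposition1p2:
  fixes n :: nat and x :: real
  shows "(deriv ^^ (n + 1)) arctan x =
    fact n * 2 ^ n * (-1) ^ n / (1 + x\<^sup>2) ^ (n + 1) *
      (\<Sum>m = 0..n div 2. acoeff m n * x ^ (n - 2 * m))"
proof -
  have "inverse (complex_of_real x - \<i>) ^ Suc n =
      (of_real x + \<i>) ^ Suc n / of_real ((1 + x\<^sup>2) ^ Suc n)"
    by (simp only: inverse_of_real_minus_i power_divide of_real_power)
  then have "Im (inverse (of_real x - \<i>) ^ Suc n) =
      lucas_poly n (2 * x) (- (1 + x\<^sup>2)) / (1 + x\<^sup>2) ^ Suc n"
    by (simp only: Im_divide_of_real Im_power_eq_lucas_poly)
  then have "(deriv ^^ Suc n) arctan x =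
      (-1) ^ n * fact n * (lucas_poly n (2 * x) (- (1 + x\<^sup>2)) / (1 + x\<^sup>2) ^ Suc n)"
    by (simp only: higher_deriv_arctan)
  then show ?thesis
    by (simp only: acoeff_poly_eq[symmetric] Suc_eq_plus1) simp
qed

end
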